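(* Let $\mathbf{O}$ be an appropriate class of continuous operators such that the functions $\check{c}$ for all $c\in\mathbb{N}$ and the functions $\mu_{k,c}$ for all $k,c\in\mathbb{N}$ are $\mathbf{O}$-representable. Let $\mathbf{M}=(M,d,A,\alpha)$ and $\mathbf{M'}=(M',d',A',\alpha')$ be effective metric spaces with $\mathrm{dom}(\alpha),\mathrm{dom}(\alpha')\subseteq\mathbb{N}$. Then every conditionally $\mathbf{O}$-computable partial function from $\mathbf{M}$ to $\mathbf{M'}$ is locally uniformly $\mathbf{O}$-computable.
   Context: $\mathbb{T}_m$ is the set of total functions $\mathbb{N}^m\to\mathbb{N}$; a $k$-ary operator is a map $\mathbb{T}_1^k\to\mathbb{T}_1$; $\check{c}\in\mathbb{T}_1$ is the constant function with value $c$. An operator $F$ is continuous if for all $f_1,\ldots,f_k\in\mathbb{T}_1$ and $n$ there is $u$ such that $F(g_1,\ldots,g_k)(n)=F(f_1,\ldots,f_k)(n)$ whenever each $g_i$ agrees with $f_i$ on all $t\le u$. A class $\mathbf{O}$ of operators is appropriate if: (1) for all $k$ and $i\le k$ the operator $(f_1,\ldots,f_k)\mapsto f_i$ is in $\mathbf{O}$; (2) the operator $F(f_1,f_2)(n)=f_1(f_2(n))$ is in $\mathbf{O}$; (3) if $F$ is $k$-ary in $\mathbf{O}$ and $G_1,\ldots,G_k$ are $l$-ary in $\mathbf{O}$, then $H(g_1,\ldots,g_l)=F(G_1(g_1,\ldots,g_l),\ldots,G_k(g_1,\ldots,g_l))$ is in $\mathbf{O}$; (4) if $F$ is $(k+1)$-ary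 in $\mathbf{O}$, then $G(f_1,\ldots,f_k)(n)=F(f_1,\ldots,f_k,\check{n})(n)$ is in $\mathbf{O}$. For $f:\mathbb{N}^k\to\mathbb{N}$, $\mathring{f}(f_1,\ldots,f_k)(n)=f(f_1(n),\ldots,f_k(n))$; $f$ is $\mathbf{O}$-representable if $\mathring{f}\in\mathbf{O}$. $\mu_{k,c}(x,y)=c$ if $x=k$, and $y$ otherwise. An effective metric space $(M,d,A,\alpha)$ (Weihrauch, Def. 8.1.2) consists of a metric space $(M,d)$, a dense subset $A\subseteq M$ and a notation $\alpha$ of $A$ (surjective partial map onto $A$), here with $\mathrm{dom}(\alpha)\subseteq\mathbb{N}$. An ordinary name of $\xi\in M$ is $f\in\mathbb{T}_1$ with $f(t)\in\mathrm{dom}(\alpha)$ and $d(\alpha(f(t)),\xi)<\frac{1}{t+1}$ for all $t$. A partial function $\theta:D\to M'$, $D\subseteq M$, is uniformly $\mathbf{O}$-computable if there is a unary $T\in\mathbf{O}$ such that whenever $\xi\in D$ and $f$ is an ordinary name of $\xi$, $T(f)$ is an ordinary name of $\theta(\xi)$; it is conditionally $\mathbf{O}$-computable if there exist a unary $E\in\mathbf{O}$ and a binary $T\in\mathbf{O}$ such that whenever $\xi\in D$ and $f$ is an ordinary name of $\xi$, there is $s$ with $E(f)(s)=0$, and $T(f,\check s)$ is an ordinary name of $\theta(\xi)$ for every such $s$; it is locally uniformly $\mathbf{O}$-computable if every point of $D$ has a neighbourhood $U$ in $M$ such that the restriction of $\theta$ to $D\cap U$ is uniformly $\mathbf{O}$-computable.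 *)

theory Defs
  imports "HOL-Analysis.Analysis"
begin

text \<open>
  A \<open>k\<close>-ary operator is a map on the lists of length \<open>k\<close> over \<open>nat \<Rightarrow> nat\<close>, extended by
  \<open>undefined\<close> to all other lists, so that equality of terms is equality of \<open>k\<close>-ary operators.
  The arity \<open>k = 0\<close> is allowed. Components are counted from \<open>0\<close>.
\<close>

type_synonym operator = "(nat \<Rightarrow> nat) list \<Rightarrow> (nat \<Rightarrow> nat)"

definition tuples :: "nat \<Rightarrow> (nat \<Rightarrow> nat) list set" where
  "tuples k = {fs. length fs = k}"

definition operators :: "nat \<Rightarrow> operator set" where
  "operators k = tuples k \<rightarrow>\<^sub>E UNIV"

text \<open>A class of operators is given as a family \<open>C\<close>, where \<open>C k\<close> is the set of its \<open>k\<close>-ary members.\<close>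

type_synonym operator_class = "nat \<Rightarrow> operator set"

definition operator_class :: "operator_class \<Rightarrow> bool" where
  "operator_class C \<longleftrightarrow> (\<forall>k. C k \<subseteq> operators k)"

definition const_fun :: "nat \<Rightarrow> nat \<Rightarrow> nat" where
  "const_fun c = (\<lambda>_. c)"

definition continuous_operator :: "nat \<Rightarrow> operator \<Rightarrow> bool" where
  "continuous_operator k F \<longleftrightarrow>
    (\<forall>fs \<in> tuples k. \<forall>n. \<exists>u. \<forall>gs \<in> tuples k.
      (\<forall>i<k. \<forall>t\<le>u. (gs ! i) t = (fs ! i) t) \<longrightarrow> F gs n = F fs n)"

definition appropriate :: "operator_class \<Rightarrow> bool" where
  "appropriate C \<longleftrightarrow>
    operator_class C \<and>
    (\<forall>k. \<forall>i<k. (\<lambda>fs \<in> tuples k. fs ! i) \<in> C k) \<and>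
    (\<lambda>fs \<in> tuples 2. \<lambda>n. (fs ! 0) ((fs ! 1) n)) \<in> C 2 \<and>
    (\<forall>k l. \<forall>F \<in> C k. \<forall>Gs. length Gs = k \<and> set Gs \<subseteq> C l \<longrightarrow>
      (\<lambda>gs \<in> tuples l. F (map (\<lambda>G. G gs) Gs)) \<in> C l) \<and>
    (\<forall>k. \<forall>F \<in> C (k + 1). (\<lambda>fs \<in> tuples k. \<lambda>n. F (fs @ [const_fun n]) n) \<in> C k)"

text \<open>A function of \<open>k\<close> arguments on the naturals is passed as a function on lists of length \<open>k\<close>.\<close>

definition pointwise :: "nat \<Rightarrow> (nat list \<Rightarrow> nat) \<Rightarrow> operator" where
  "pointwise k f = (\<lambda>fs \<in> tuples k. \<lambda>n. f (map (\<lambda>g. g n) fs))"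

definition representable :: "operator_class \<Rightarrow> nat \<Rightarrow> (nat list \<Rightarrow> nat) \<Rightarrow> bool" where
  "representable C k f \<longleftrightarrow> pointwise k f \<in> C k"

definition mu_fun :: "nat \<Rightarrow> nat \<Rightarrow> nat \<Rightarrow> nat \<Rightarrow> nat" where
  "mu_fun k c x y = (if x = k then c else y)"

record 'a effective_space =
  points :: "'a set"
  distance :: "'a \<Rightarrow> 'a \<Rightarrow> real"
  dense_set :: "'a set"
  numbering :: "nat \<rightharpoonup> 'a"

abbreviation space_topology :: "'a effective_space \<Rightarrow> 'a topology" where
  "space_topology X \<equiv> Metric_space.mtopology (points X) (distance X)"

definition effective_metric_space :: "'a effective_space \<Rightarrow> bool" where
  "effective_metric_space X \<longleftrightarrow>
    Metric_space (points X) (distance X) \<and>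
    dense_set X \<subseteq> points X \<and>
    space_topology X closure_of dense_set X = points X \<and>
    ran (numbering X) = dense_set X"

definition ordinary_name :: "'a effective_space \<Rightarrow> 'a \<Rightarrow> (nat \<Rightarrow> nat) \<Rightarrow> bool" where
  "ordinary_name X \<xi> f \<longleftrightarrow>
    \<xi> \<in> points X \<and>
    (\<forall>t. f t \<in> dom (numbering X) \<and>
      distance X (the (numbering X (f t))) \<xi> < 1 / (real t + 1))"

definition partial_function_between ::
    "'a effective_space \<Rightarrow> 'b effective_space \<Rightarrow> ('a \<rightharpoonup> 'b) \<Rightarrow> bool" where
  "partial_function_between X Y \<theta> \<longleftrightarrow> dom \<theta> \<subseteq> points X \<and> ran \<theta> \<subseteq> points Y"

definition uniformly_computable ::
    "operator_class \<Rightarrow> 'a effective_space \<Rightarrow> 'b effective_space \<Rightarrow> ('a \<rightharpoonup> 'b) \<Rightarrow> bool" where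
  "uniformly_computable C X Y \<theta> \<longleftrightarrow>
    (\<exists>T \<in> C 1. \<forall>\<xi> \<in> dom \<theta>. \<forall>f.
      ordinary_name X \<xi> f \<longrightarrow> ordinary_name Y (the (\<theta> \<xi>)) (T [f]))"

definition conditionally_computable ::
    "operator_class \<Rightarrow> 'a effective_space \<Rightarrow> 'b effective_space \<Rightarrow> ('a \<rightharpoonup> 'b) \<Rightarrow> bool" where
  "conditionally_computable C X Y \<theta> \<longleftrightarrow>
    (\<exists>E \<in> C 1. \<exists>T \<in> C 2. \<forall>\<xi> \<in> dom \<theta>. \<forall>f. ordinary_name X \<xi> f \<longrightarrow>
      (\<exists>s. E [f] s = 0) \<and>
      (\<forall>s. E [f] s = 0 \<longrightarrow> ordinary_name Y (the (\<theta> \<xi>)) (T [f, const_fun s])))"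

definition neighbourhood_in :: "'a topology \<Rightarrow> 'a \<Rightarrow> 'a set \<Rightarrow> bool" where
  "neighbourhood_in X x U \<longleftrightarrow>
    U \<subseteq> topspace X \<and> (\<exists>V. openin X V \<and> x \<in> V \<and> V \<subseteq> U)"

definition locally_uniformly_computable ::
    "operator_class \<Rightarrow> 'a effective_space \<Rightarrow> 'b effective_space \<Rightarrow> ('a \<rightharpoonup> 'b) \<Rightarrow> bool" where
  "locally_uniformly_computable C X Y \<theta> \<longleftrightarrow>
    (\<forall>\<xi> \<in> dom \<theta>. \<exists>U. neighbourhood_in (space_topology X) \<xi> U \<and>
      uniformly_computable C X Y (\<theta> |` U))"

end

theory Submission imports Defs begin

text \<open>
  Fix a name \<open>f\<^sub>0\<close> of \<open>\<xi>\<^sub>0\<close> and \<open>s\<close> with \<open>E(f\<^sub>0)(s) = 0\<close>. By continuity \<open>E(g)(s) = 0\<close> for every \<open>g\<close> that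
  agrees with \<open>f\<^sub>0\<close> below some \<open>m\<close>. Since the inequalities in the definition of a name are strict,
  the points for which \<open>f\<^sub>0(0), \<dots>, f\<^sub>0(m-1)\<close> is an admissible beginning of a name form a
  neighbourhood of \<open>\<xi>\<^sub>0\<close>. For such points, overwriting the beginning of any name with that of \<open>f\<^sub>0\<close>
  gives another name, for which the fixed \<open>s\<close> is a valid condition. Overwriting finitely many
  values is an operator in the class, being a composition of functions \<open>\<mu>\<^bsub>k,c\<^esub>\<close>.
\<close>

text \<open>The prefix is a total function \<open>h\<close> cut at \<open>m\<close>, not a list, so
  that an induction on \<open>m\<close> can keep \<open>h\<close> fixed.\<close>

definition overwrite_below :: "nat \<Rightarrow> (nat \<Rightarrow> nat) \<Rightarrow> (nat \<Rightarrow> nat) \<Rightarrow> nat \<Rightarrow> nat" where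
  "overwrite_below m h f = (\<lambda>n. if n < m then h n else f n)"

lemma appropriate_proj:
  assumes "appropriate C" "i < k"
  shows "(\<lambda>fs \<in> tuples k. fs ! i) \<in> C k"
  using assms unfolding appropriate_def by blast

lemma appropriate_compose:
  assumes "appropriate C" "F \<in> C k" "length Gs = k" "set Gs \<subseteq> C l"
  shows "(\<lambda>gs \<in> tuples l. F (map (\<lambda>G. G gs) Gs)) \<in> C l"
  using assms unfolding appropriate_def by blast

lemma appropriate_diagonal:
  assumes "appropriate C" "F \<in> C (k + 1)"
  shows "(\<lambda>fs \<in> tuples k. \<lambda>n. F (fs @ [const_fun n]) n) \<in> C k"
  using assms unfolding appropriate_def by blast

text \<open>Diagonalising the last projection of \<open>k + 1\<close> arguments works: it selects
  the appended \<open>const_fun n\<close>, whose value at \<open>n\<close> is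
  \<open>n\<close>.\<close>

lemma appropriate_identity:
  assumes "appropriate C"
  shows "(\<lambda>fs \<in> tuples k. \<lambda>n. n) \<in> C k"
proof -
  have "(\<lambda>fs \<in> tuples k. \<lambda>n. (\<lambda>fs \<in> tuples (k + 1). fs ! k) (fs @ [const_fun n]) n) \<in> C k"
    using assms by (intro appropriate_diagonal appropriate_proj) auto
  also have "(\<lambda>fs \<in> tuples k. \<lambda>n. (\<lambda>fs \<in> tuples (k + 1). fs ! k) (fs @ [const_fun n]) n)
      = (\<lambda>fs \<in> tuples k. \<lambda>n. n)"
    by (rule restrict_ext) (auto simp: tuples_def const_fun_def nth_append)
  finally show ?thesis .
qed

text \<open>One further value is overwritten by applying \<open>mu_fun m (h m)\<close> pointwise to
  the identity and the operator for \<open>m\<close>: at \<open>n = m\<close> it returns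
  \<open>h m\<close>, elsewhere it passes the old value on. Only finitely many values of
  \<open>h\<close> enter, so \<open>h\<close> may be arbitrary.\<close>

lemma appropriate_overwrite_below:
  assumes "appropriate C"
    and mu: "\<And>k c. representable C 2 (\<lambda>xs. mu_fun k c (xs ! 0) (xs ! 1))"
  shows "(\<lambda>fs \<in> tuples 1. overwrite_below m h (fs ! 0)) \<in> C 1"
proof (induction m)
  case 0
  show ?case
    using appropriate_proj[OF assms(1), of 0 1] by (simp add: overwrite_below_def del: restrict_apply)
next
  case (Suc m)
  let ?P = "\<lambda>fs \<in> tuples 1. overwrite_below m h (fs ! 0)"
  let ?I = "\<lambda>fs \<in> tuples 1. \<lambda>n::nat. n"
  let ?M = "pointwise 2 (\<lambda>xs. mu_fun m (h m) (xs ! 0) (xs ! 1))"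
  have "(\<lambda>gs \<in> tuples 1. ?M (map (\<lambda>G. G gs) [?I, ?P])) \<in> C 1"
    using assms(1) mu[unfolded representable_def] Suc appropriate_identity[OF assms(1)]
    by (intro appropriate_compose[where k = 2]) (auto simp del: restrict_apply)
  also have "(\<lambda>gs \<in> tuples 1. ?M (map (\<lambda>G. G gs) [?I, ?P]))
      = (\<lambda>fs \<in> tuples 1. overwrite_below (Suc m) h (fs ! 0))"
    by (rule restrict_ext)
      (auto simp: tuples_def pointwise_def mu_fun_def overwrite_below_def fun_eq_iff)
  finally show ?case .
qed

text \<open>Density puts a point of \<open>dense_set X\<close> in each ball around \<xi>,
  surjectivity of the numbering gives it an index, and choice collects the indices. A first name is
  what makes a witness \<open>s\<close> available.\<close>

lemma ordinary_name_exists: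
  assumes "effective_metric_space X" "\<xi> \<in> points X"
  shows "\<exists>f. ordinary_name X \<xi> f"
proof -
  interpret Metric_space "points X" "distance X"
    using assms unfolding effective_metric_space_def by blast
  have "\<exists>i. i \<in> dom (numbering X) \<and> distance X (the (numbering X i)) \<xi> < 1 / (real t + 1)" for t
  proof -
    have "\<xi> \<in> mtopology closure_of dense_set X"
      using assms unfolding effective_metric_space_def by simp
    moreover have "1 / (real t + 1) > 0"
      by simp
    ultimately obtain a where "a \<in> dense_set X" "a \<in> mball \<xi> (1 / (real t + 1))"
      unfolding metric_closure_of by blast
    moreover then obtain i where "numbering X i = Some a"
      using assms unfolding effective_metric_space_def ran_def by blast
    ultimately show ?thesis
      by (auto simp: commute intro!: exI[of _ i])
  qed
  then show ?thesis
    using assms(2) unfolding ordinary_name_def by metis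
qed

lemma ordinary_name_overwrite_below:
  assumes "ordinary_name X \<xi> f"
    and "\<And>t. t < m \<Longrightarrow> h t \<in> dom (numbering X)"
    and "\<And>t. t < m \<Longrightarrow> distance X (the (numbering X (h t))) \<xi> < 1 / (real t + 1)"
  shows "ordinary_name X \<xi> (overwrite_below m h f)"
  using assms unfolding ordinary_name_def overwrite_below_def by auto

lemma neighbourhood_in_name_prefix:
  assumes "effective_metric_space X" "ordinary_name X \<xi> h"
  shows "neighbourhood_in (space_topology X) \<xi>
    {x \<in> points X. \<forall>t<m. distance X (the (numbering X (h t))) x < 1 / (real t + 1)}"
    (is "neighbourhood_in _ _ ?U")
proof -
  interpret Metric_space "points X" "distance X"
    using assms unfolding effective_metric_space_def by blast
  have mem: "the (numbering X (h t)) \<in> points X" for t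
  proof -
    have "h t \<in> dom (numbering X)"
      using assms(2) unfolding ordinary_name_def by blast
    then have "the (numbering X (h t)) \<in> ran (numbering X)"
      by (auto intro: ranI)
    then show ?thesis
      using assms(1) unfolding effective_metric_space_def by auto
  qed
  \<comment> \<open>The factor \<open>topspace mtopology\<close> covers \<open>m = 0\<close>, where
    the intersection of the balls is \<open>UNIV\<close>.\<close>
  have "?U = topspace mtopology \<inter> (\<Inter>t\<in>{..<m}. mball (the (numbering X (h t))) (1 / (real t + 1)))"
    using mem by auto
  also have "openin mtopology \<dots>"
    by (intro openin_Int_Inter) auto
  finally have "openin mtopology ?U" .
  moreover have "\<xi> \<in> ?U"
    using assms(2) unfolding ordinary_name_def by blast
  ultimately show ?thesis
    unfolding neighbourhood_in_def by auto
qed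

theorem theorem5:
  fixes C :: operator_class
    and X :: "'a effective_space"
    and Y :: "'b effective_space"
    and \<theta> :: "'a \<rightharpoonup> 'b"
  assumes "appropriate C"
    and "\<And>k F. F \<in> C k \<Longrightarrow> continuous_operator k F"
    and "\<And>c. representable C 1 (\<lambda>xs. const_fun c (xs ! 0))"
    and "\<And>k c. representable C 2 (\<lambda>xs. mu_fun k c (xs ! 0) (xs ! 1))"
    and "effective_metric_space X"
    and "effective_metric_space Y"
    and "partial_function_between X Y \<theta>"
    and "conditionally_computable C X Y \<theta>"
  shows "locally_uniformly_computable C X Y \<theta>"
  unfolding locally_uniformly_computable_def
proof
  fix \<xi>\<^sub>0 assume \<xi>\<^sub>0: "\<xi>\<^sub>0 \<in> dom \<theta>"
  obtain E T where E: "E \<in> C 1" and T: "T \<in> C 2"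
    and ET: "\<forall>\<xi> \<in> dom \<theta>. \<forall>f. ordinary_name X \<xi> f \<longrightarrow> (\<exists>s. E [f] s = 0) \<and>
      (\<forall>s. E [f] s = 0 \<longrightarrow> ordinary_name Y (the (\<theta> \<xi>)) (T [f, const_fun s]))"
    using assms(8) unfolding conditionally_computable_def by blast
  have name: "ordinary_name Y (the (\<theta> \<xi>)) (T [f, const_fun s])"
    if "\<xi> \<in> dom \<theta>" "ordinary_name X \<xi> f" "E [f] s = 0" for \<xi> f s
    using ET that by blast
  have "\<xi>\<^sub>0 \<in> points X"
    using \<xi>\<^sub>0 assms(7) unfolding partial_function_between_def by blast
  from ordinary_name_exists[OF assms(5) this] obtain h where h: "ordinary_name X \<xi>\<^sub>0 h" ..
  obtain s where s: "E [h] s = 0"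
    using ET \<xi>\<^sub>0 h by blast
  have "[h] \<in> tuples 1"
    by (simp add: tuples_def)
  then obtain u where u: "\<And>gs. gs \<in> tuples 1 \<Longrightarrow> (\<forall>i<1. \<forall>t\<le>u. (gs ! i) t = ([h] ! i) t)
      \<Longrightarrow> E gs s = E [h] s"
    using assms(2)[OF E] unfolding continuous_operator_def by meson
  \<comment> \<open>Continuity asks for agreement at all \<open>t\<close> up to and including
    \<open>u\<close>.\<close>
  let ?m = "Suc u"
  have zero: "E [overwrite_below ?m h f] s = 0" for f
    using u[of "[overwrite_below ?m h f]"] s by (simp add: tuples_def overwrite_below_def)
  define U where
    "U = {x \<in> points X. \<forall>t<?m. distance X (the (numbering X (h t))) x < 1 / (real t + 1)}"
  let ?P = "\<lambda>fs \<in> tuples 1. overwrite_below ?m h (fs ! 0)"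
  \<comment> \<open>Representability of constants supplies \<open>const_fun s\<close> as the value
    of a unary operator, which fixes the second argument of \<open>T\<close>.\<close>
  let ?K = "pointwise 1 (\<lambda>xs. const_fun s (xs ! 0))"
  define S where "S = (\<lambda>gs \<in> tuples 1. T (map (\<lambda>G. G gs) [?P, ?K]))"
  have "S \<in> C 1"
    unfolding S_def
    using assms(1) T assms(3)[unfolded representable_def]
      appropriate_overwrite_below[OF assms(1) assms(4)]
    by (intro appropriate_compose[where k = 2]) (auto simp del: restrict_apply)
  moreover have "S [f] = T [overwrite_below ?m h f, const_fun s]" for f
    by (simp add: S_def tuples_def pointwise_def const_fun_def)
  \<comment> \<open>The inequalities at the overwritten places come from \<open>U\<close>, the
    domain condition from \<open>h\<close> being a name.\<close>
  moreover have "ordinary_name X \<xi> (overwrite_below ?m h f)"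
    if "\<xi> \<in> U" "ordinary_name X \<xi> f" for \<xi> f
    using that h by (intro ordinary_name_overwrite_below) (auto simp: U_def ordinary_name_def)
  ultimately have "uniformly_computable C X Y (\<theta> |` U)"
    unfolding uniformly_computable_def using name[OF _ _ zero]
    by (intro bexI[of _ S]) (simp_all add: dom_restrict)
  moreover have "neighbourhood_in (space_topology X) \<xi>\<^sub>0 U"
    unfolding U_def using neighbourhood_in_name_prefix[OF assms(5) h] .
  ultimately show "\<exists>U. neighbourhood_in (space_topology X) \<xi>\<^sub>0 U \<and> uniformly_computable C X Y (\<theta> |` U)"
    by blast
qed

end
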